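(* Let $\underline b<0<\overline b$ be real numbers and let $M=(M_t:0\le t\le\infty)$ be a continuous uniformly integrable martingale with $M_0=0$ a.s. Then $$\mathbb P\big(\overline M_\infty\ge\overline b,\ \underline M_\infty>\underline b\big)\ \le\ \inf\Big\{\mathbb E\big[\overline G^{I}(K)\big],\ \mathbb E\big[\overline G^{II}\big],\ \mathbb E\big[\overline G^{III}(K')\big]\Big\},$$ where the infimum is taken over all $K,K'$ with $0<K'<\overline b<K$, and $\overline G^{I}(K),\overline G^{II},\overline G^{III}(K')$ are the random variables $$\overline G^{I}(K)=\frac{1}{K-\underline b}\Big((M_\infty-K)^+-(\underline b-M_\infty)^+-(M_\infty-\underline b)\mathbf 1_{\{H_{\underline b}<\infty\}}\Big)+\mathbf 1_{\{M_\infty>\underline b\}},$$ $$\overline G^{II}=\frac{M_\infty-\underline b}{\overline b-\underline b}-\frac{M_\infty-\overline b}{\overline b-\underline b}\mathbf 1_{\{H_{\overline b}<H_{\underline b},\ H_{\overline b}<\infty\}}-\frac{M_\infty-\underline b}{\overline b-\underline b}\mathbf 1_{\{H_{\underline b}<H_{\overline b},\ H_{\underline b}<\infty\}},$$ $$\overline G^{III}(K')=\frac{(M_\infty-K')^+}{\overline b-K'}+\frac{\overline b-M_\infty}{\overline b-K'}\mathbf 1_{\{\overline M_\infty\ge\overline b\}}.$$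
   Context: $M_\infty=\lim_{t\to\infty}M_t$; $\overline M_\infty=\sup_{t\le\infty}M_t$ and $\underline M_\infty=\inf_{t\le\infty}M_t$. $H_x=\inf\{t\in[0,\infty]:M_t=x\}$ with $\inf\emptyset=\infty$. $a^+=\max\{a,0\}$. *)

theory Defs
  imports "HOL-Probability.Probability"
begin

text \<open>
  A process in continuous time is a family \<open>M :: real \<Rightarrow> 'a \<Rightarrow> real\<close> of which only the
  times \<open>t \<ge> 0\<close> matter; all conditions are restricted to these times.
\<close>

definition is_filtration :: "'a measure \<Rightarrow> (real \<Rightarrow> 'a measure) \<Rightarrow> bool" where
  "is_filtration P F \<longleftrightarrow>
     (\<forall>t\<ge>0. subalgebra P (F t)) \<and> (\<forall>s\<ge>0. \<forall>t\<ge>s. subalgebra (F t) (F s))"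

definition is_martingale ::
  "'a measure \<Rightarrow> (real \<Rightarrow> 'a measure) \<Rightarrow> (real \<Rightarrow> 'a \<Rightarrow> real) \<Rightarrow> bool" where
  "is_martingale P F M \<longleftrightarrow>
     (\<forall>t\<ge>0. M t \<in> borel_measurable (F t)) \<and>
     (\<forall>t\<ge>0. integrable P (M t)) \<and>
     (\<forall>s\<ge>0. \<forall>t\<ge>s. AE \<omega> in P. real_cond_exp P (F s) (M t) \<omega> = M s \<omega>)"

definition uniformly_integrable_on ::
  "'a measure \<Rightarrow> 'i set \<Rightarrow> ('i \<Rightarrow> 'a \<Rightarrow> real) \<Rightarrow> bool" where
  "uniformly_integrable_on P I X \<longleftrightarrow>
     (\<forall>i\<in>I. X i \<in> borel_measurable P) \<and>
     ((\<lambda>c::real. SUP i\<in>I. \<integral>\<^sup>+\<omega>. ennreal \<bar>X i \<omega>\<bar> * indicator {\<omega>. c < \<bar>X i \<omega>\<bar>} \<omega> \<partial>P)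
        \<longlongrightarrow> 0) at_top"

definition continuous_paths :: "'a measure \<Rightarrow> (real \<Rightarrow> 'a \<Rightarrow> real) \<Rightarrow> bool" where
  "continuous_paths P M \<longleftrightarrow> (\<forall>\<omega>\<in>space P. continuous_on {0..} (\<lambda>t. M t \<omega>))"

text \<open>
  The limit is taken pathwise. On paths without a limit, \<open>Lim\<close> is a fixed
  unspecified constant; for a uniformly integrable continuous martingale these
  paths form a null set.
\<close>

definition M_inf :: "(real \<Rightarrow> 'a \<Rightarrow> real) \<Rightarrow> 'a \<Rightarrow> real" where
  "M_inf M \<omega> = Lim at_top (\<lambda>t. M t \<omega>)"

text \<open>The process with time set \<open>[0,\<infinity>]\<close>, represented by the type \<open>ennreal\<close>.\<close>

definition M_at :: "(real \<Rightarrow> 'a \<Rightarrow> real) \<Rightarrow> ennreal \<Rightarrow> 'a \<Rightarrow> real" where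
  "M_at M t \<omega> = (if t = \<infinity> then M_inf M \<omega> else M (enn2real t) \<omega>)"

definition M_sup :: "(real \<Rightarrow> 'a \<Rightarrow> real) \<Rightarrow> 'a \<Rightarrow> ereal" where
  "M_sup M \<omega> = (SUP t. ereal (M_at M t \<omega>))"

definition M_low :: "(real \<Rightarrow> 'a \<Rightarrow> real) \<Rightarrow> 'a \<Rightarrow> ereal" where
  "M_low M \<omega> = (INF t. ereal (M_at M t \<omega>))"

text \<open>In \<open>ennreal\<close> the infimum of the empty set is \<open>\<infinity>\<close>.\<close>

definition hitting :: "(real \<Rightarrow> 'a \<Rightarrow> real) \<Rightarrow> real \<Rightarrow> 'a \<Rightarrow> ennreal" where
  "hitting M x \<omega> = Inf {t. M_at M t \<omega> = x}"

definition pos_part :: "real \<Rightarrow> real" where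
  "pos_part a = max a 0"

definition G_I :: "(real \<Rightarrow> 'a \<Rightarrow> real) \<Rightarrow> real \<Rightarrow> real \<Rightarrow> 'a \<Rightarrow> real" where
  "G_I M bl K \<omega> =
     1 / (K - bl) *
       (pos_part (M_inf M \<omega> - K) - pos_part (bl - M_inf M \<omega>)
         - (M_inf M \<omega> - bl) * of_bool (hitting M bl \<omega> < \<infinity>))
     + of_bool (M_inf M \<omega> > bl)"

definition G_II :: "(real \<Rightarrow> 'a \<Rightarrow> real) \<Rightarrow> real \<Rightarrow> real \<Rightarrow> 'a \<Rightarrow> real" where
  "G_II M bl bu \<omega> =
     (M_inf M \<omega> - bl) / (bu - bl)
     - (M_inf M \<omega> - bu) / (bu - bl)
         * of_bool (hitting M bu \<omega> < hitting M bl \<omega> \<and> hitting M bu \<omega> < \<infinity>)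
     - (M_inf M \<omega> - bl) / (bu - bl)
         * of_bool (hitting M bl \<omega> < hitting M bu \<omega> \<and> hitting M bl \<omega> < \<infinity>)"

definition G_III :: "(real \<Rightarrow> 'a \<Rightarrow> real) \<Rightarrow> real \<Rightarrow> real \<Rightarrow> 'a \<Rightarrow> real" where
  "G_III M bu K' \<omega> =
     pos_part (M_inf M \<omega> - K') / (bu - K')
     + (bu - M_inf M \<omega>) / (bu - K') * of_bool (M_sup M \<omega> \<ge> ereal bu)"

end

theory Submission
  imports Defs
begin

text \<open>
  Each bound dominates the indicator of the event \<open>{M_sup \<ge> bu, M_low > bl}\<close> path by path, so no
  optional stopping is needed: it suffices to check the inequality on continuous paths that start
  at \<open>0\<close> and converge to \<open>M_inf\<close>, and to take expectations. The probabilistic content is the almost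
  sure convergence of \<open>M\<close>. The expectations of a Huber function of \<open>M t\<close> increase to a finite limit;
  together with uniform integrability this makes \<open>M\<close> Cauchy in \<open>L\<^sup>1\<close>, and Doob's maximal inequality
  upgrades this to pathwise convergence. Integrability of \<open>M_inf\<close> follows from Fatou's lemma.
\<close>

section \<open>Continuous functions along rational times\<close>

text \<open>A uniformly integrable martingale need not be square integrable, so orthogonality of
  increments in L2 is not directly available. The Huber function repairs this: on
  \<open>[-R, R]\<close> it is quadratic and returns the square of an increment exactly, while its
  slope never exceeds \<open>2 * R\<close>, so that its expectation is controlled by that of
  \<open>\<bar>M t\<bar>\<close>. What happens outside \<open>[-R, R]\<close> is small uniformly in
  time by uniform integrability. A second obstacle is that time is uncountable. Convergence, hitting
  a level and the supremum are therefore each expressed through rational times, using that every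
  path in \<open>space P\<close> is continuous. The three payoffs have a financial reading: a static
  position in \<open>M_inf\<close> together with forward trades entered at the price
  \<open>bl\<close> or \<open>bu\<close> when that level is reached. Pathwise domination says that
  each one superhedges the event.\<close>

text \<open>Rationals are sought to the right because a point to the left could leave
  \<open>{a..}\<close> or the tail on which an estimate is known; the upper limit \<open>b\<close>
  serves compact intervals.\<close>

lemma continuous_on_rational_right:
  fixes f :: "real \<Rightarrow> 'b::topological_space"
  assumes "continuous_on {a..} f" "a \<le> t" "t < b" "open U" "f t \<in> U"
  obtains q where "q \<in> \<rat>" "t < q" "q < b" "f q \<in> U"
proof -
  have "continuous_on {t..} f"
    by (rule continuous_on_subset[OF assms(1)]) (use assms(2) in auto)
  then have "(f \<longlongrightarrow> f t) (at t within {t..})"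
    by (simp add: continuous_on_def)
  then have "(f \<longlongrightarrow> f t) (at_right t)"
    by (rule tendsto_within_subset) auto
  then have "\<forall>\<^sub>F x in at_right t. f x \<in> U"
    using assms(4,5) by (simp add: topological_tendstoD)
  then obtain c where c: "t < c" "\<And>x. t < x \<Longrightarrow> x < c \<Longrightarrow> f x \<in> U"
    by (auto simp: eventually_at_right_field)
  obtain q where "q \<in> \<rat>" "t < q" "q < min b c"
    using Rats_dense_in_real[of t "min b c"] assms(3) c(1) by auto
  then show thesis
    using that c(2) by auto
qed

text \<open>This is Cauchy's criterion with the integer \<open>n\<close> as common reference time.
  All its quantifiers are countable, which makes the set of convergent paths measurable and
  accessible to a maximal inequality over rational times.\<close>

lemma continuous_on_tendsto_at_top_iff_rational:
  fixes f :: "real \<Rightarrow> real"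
  assumes "continuous_on {0..} f"
  shows "(\<exists>l. (f \<longlongrightarrow> l) at_top) \<longleftrightarrow>
    (\<forall>k::nat. \<exists>n::nat. \<forall>q\<in>\<rat> \<inter> {real n..}. \<bar>f q - f n\<bar> \<le> 1 / real (Suc k))"
    (is "?L \<longleftrightarrow> ?R")
proof
  assume ?L
  then obtain l where l: "(f \<longlongrightarrow> l) at_top" by blast
  show ?R
  proof
    fix k :: nat
    define e where "e = 1 / real (Suc k)"
    have "\<forall>\<^sub>F x in at_top. dist (f x) l < e / 2"
      by (rule tendstoD[OF l]) (simp add: e_def)
    then obtain N where N: "\<And>x. N \<le> x \<Longrightarrow> dist (f x) l < e / 2"
      by (auto simp: eventually_at_top_linorder)
    obtain n :: nat where n: "N \<le> real n"
      using real_arch_simple by blast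
    have "\<bar>f q - f n\<bar> \<le> e" if "real n \<le> q" for q
      using N[of q] N[of "real n"] n that unfolding dist_real_def by linarith
    then show "\<exists>n::nat. \<forall>q\<in>\<rat> \<inter> {real n..}. \<bar>f q - f n\<bar> \<le> 1 / real (Suc k)"
      unfolding e_def by (intro exI[of _ n]) auto
  qed
next
  assume R: ?R
  have R': "\<exists>n::nat. \<forall>t\<ge>real n. \<bar>f t - f n\<bar> < e" if e: "0 < e" for e
  proof -
    obtain k where k: "1 / real (Suc k) < e"
      using e nat_approx_posE by blast
    obtain n :: nat where n: "\<And>q. q \<in> \<rat> \<Longrightarrow> real n \<le> q \<Longrightarrow> \<bar>f q - f n\<bar> \<le> 1 / real (Suc k)"
      using R by (meson IntI atLeast_iff)
    have "\<bar>f t - f n\<bar> < e" if t: "real n \<le> t" for t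
    proof (rule ccontr)
      assume "\<not> \<bar>f t - f n\<bar> < e"
      \<comment> \<open>The estimate at rationals is non-strict, so its failure at \<open>t\<close>
        is an open condition and persists at some rational just after \<open>t\<close>.\<close>
      then have "f t \<in> {y. 1 / real (Suc k) < \<bar>y - f n\<bar>}"
        using k by simp
      moreover have "open {y. 1 / real (Suc k) < \<bar>y - f n\<bar>}"
        by (intro open_Collect_less continuous_intros)
      ultimately obtain q where "q \<in> \<rat>" "t < q" "f q \<in> {y. 1 / real (Suc k) < \<bar>y - f n\<bar>}"
        using continuous_on_rational_right[OF assms, of t "t + 1"] t by auto
      then show False
        using n[of q] t by auto
    qed
    then show ?thesis by blast
  qed
  have "Cauchy (\<lambda>n. f (real n))"
  proof (rule metric_CauchyI)
    fix e :: real assume "0 < e"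
    then obtain n :: nat where n: "\<And>t. real n \<le> t \<Longrightarrow> \<bar>f t - f n\<bar> < e / 2"
      using R'[of "e / 2"] by auto
    have "dist (f (real i)) (f (real j)) < e" if "i \<ge> n" "j \<ge> n" for i j
      using n[of "real i"] n[of "real j"] that unfolding dist_real_def by linarith
    then show "\<exists>N. \<forall>i\<ge>N. \<forall>j\<ge>N. dist (f (real i)) (f (real j)) < e"
      by blast
  qed
  then obtain l where l: "(\<lambda>n. f (real n)) \<longlonglongrightarrow> l"
    using Cauchy_convergent convergent_def by blast
  have "(f \<longlongrightarrow> l) at_top"
  proof (rule tendstoI)
    fix e :: real assume e: "0 < e"
    then obtain n :: nat where n: "\<And>t. real n \<le> t \<Longrightarrow> \<bar>f t - f n\<bar> < e / 3"
      using R'[of "e / 3"] by auto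
    obtain m where m: "\<And>i. i \<ge> m \<Longrightarrow> \<bar>f (real i) - l\<bar> < e / 3"
      using tendstoD[OF l, of "e / 3"] e
      unfolding eventually_sequentially dist_real_def by auto
    have "dist (f t) l < e" if "real n \<le> t" for t
      using n[OF that] n[of "real (max n m)"] m[of "max n m"] unfolding dist_real_def by linarith
    then show "\<forall>\<^sub>F t in at_top. dist (f t) l < e"
      by (auto simp: eventually_at_top_linorder)
  qed
  then show ?L by blast
qed

text \<open>Compactness of \<open>{0..q}\<close> turns arbitrarily good approximation into
  attainment. The countable form serves the measurability of \<open>hitting\<close>.\<close>

lemma continuous_on_attains_iff_rational:
  fixes f :: "real \<Rightarrow> real"
  assumes cont: "continuous_on {0..} f" and q: "q \<in> \<rat>" "0 \<le> q"
  shows "(\<exists>t\<in>{0..q}. f t = x) \<longleftrightarrow>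
    (\<forall>k::nat. \<exists>r\<in>\<rat> \<inter> {0..q}. \<bar>f r - x\<bar> < 1 / real (Suc k))"
proof
  assume "\<exists>t\<in>{0..q}. f t = x"
  then obtain t where t: "0 \<le> t" "t \<le> q" "f t = x" by auto
  show "\<forall>k::nat. \<exists>r\<in>\<rat> \<inter> {0..q}. \<bar>f r - x\<bar> < 1 / real (Suc k)"
  proof
    fix k :: nat
    show "\<exists>r\<in>\<rat> \<inter> {0..q}. \<bar>f r - x\<bar> < 1 / real (Suc k)"
    \<comment> \<open>At the right endpoint there is no later time inside the interval, but
      \<open>q\<close> itself is rational.\<close>
    proof (cases "t = q")
      case True
      then show ?thesis using t q by (intro bexI[of _ q]) auto
    next
      case False
      have "open {y. \<bar>y - x\<bar> < 1 / real (Suc k)}"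
        by (intro open_Collect_less continuous_intros)
      then obtain r where "r \<in> \<rat>" "t < r" "r < q" "f r \<in> {y. \<bar>y - x\<bar> < 1 / real (Suc k)}"
        using continuous_on_rational_right[OF cont, of t q "{y. \<bar>y - x\<bar> < 1 / real (Suc k)}"] t False
        by auto
      then show ?thesis using t by (intro bexI[of _ r]) auto
    qed
  qed
next
  assume R: "\<forall>k::nat. \<exists>r\<in>\<rat> \<inter> {0..q}. \<bar>f r - x\<bar> < 1 / real (Suc k)"
  have "continuous_on {0..q} (\<lambda>t. \<bar>f t - x\<bar>)"
    by (intro continuous_intros continuous_on_subset[OF cont]) auto
  then obtain t where t: "t \<in> {0..q}" "\<And>s. s \<in> {0..q} \<Longrightarrow> \<bar>f t - x\<bar> \<le> \<bar>f s - x\<bar>"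
    using continuous_attains_inf[of "{0..q}" "\<lambda>t. \<bar>f t - x\<bar>"] q by auto
  have "f t = x"
  proof (rule ccontr)
    assume "f t \<noteq> x"
    then obtain k where "1 / real (Suc k) < \<bar>f t - x\<bar>"
      using nat_approx_posE[of "\<bar>f t - x\<bar>"] by auto
    moreover obtain r where "r \<in> {0..q}" "\<bar>f r - x\<bar> < 1 / real (Suc k)"
      using R by blast
    ultimately show False
      using t(2)[of r] by linarith
  qed
  then show "\<exists>t\<in>{0..q}. f t = x"
    using t(1) by blast
qed

section \<open>The Huber function\<close>

text \<open>Twice the usual Huber loss, convex and continuously differentiable for
  \<open>0 \<le> R\<close>.\<close>

definition huber :: "real \<Rightarrow> real \<Rightarrow> real" where
  "huber R x = (if \<bar>x\<bar> \<le> R then x\<^sup>2 else 2 * R * \<bar>x\<bar> - R\<^sup>2)"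

text \<open>For \<open>0 \<le> R\<close> this is half the derivative of \<open>huber R\<close>, so
  \<open>2 * clip R x\<close> is the slope of the tangent at \<open>x\<close>.\<close>

definition clip :: "real \<Rightarrow> real \<Rightarrow> real" where
  "clip R x = max (- R) (min R x)"

lemma huber_measurable [measurable]: "huber R \<in> borel_measurable borel"
  unfolding huber_def by measurable

lemma clip_measurable [measurable]: "clip R \<in> borel_measurable borel"
  unfolding clip_def by measurable

lemma abs_clip_le: "0 \<le> R \<Longrightarrow> \<bar>clip R x\<bar> \<le> R"
  by (auto simp: clip_def)

lemma huber_nonneg: "0 \<le> R \<Longrightarrow> 0 \<le> huber R x"
proof (cases "\<bar>x\<bar> \<le> R")
  case False
  assume "0 \<le> R"
  then have "R * R \<le> R * \<bar>x\<bar>" "0 \<le> R * \<bar>x\<bar>"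
    using False by (auto intro!: mult_left_mono)
  then show ?thesis
    using False by (simp add: huber_def power2_eq_square)
qed (simp add: huber_def)

lemma huber_le: "0 \<le> R \<Longrightarrow> huber R x \<le> 2 * R * \<bar>x\<bar>"
proof (cases "\<bar>x\<bar> \<le> R")
  case True
  assume "0 \<le> R"
  then have "0 \<le> R * \<bar>x\<bar>"
    by simp
  moreover have "x\<^sup>2 \<le> R * \<bar>x\<bar>"
    using mult_right_mono[OF True abs_ge_zero[of x]] by (simp add: power2_eq_square)
  ultimately have "x\<^sup>2 \<le> 2 * R * \<bar>x\<bar>"
    by linarith
  then show ?thesis
    using True by (simp add: huber_def)
qed (simp add: huber_def)

text \<open>The left side is the Bregman divergence of \<open>huber R\<close>; on the quadratic
  region it is that of the square.\<close>

lemma huber_tangent_eq: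
  assumes "\<bar>x\<bar> \<le> R" "\<bar>y\<bar> \<le> R"
  shows "huber R y - huber R x - 2 * clip R x * (y - x) = (y - x)\<^sup>2"
  using assms by (simp add: huber_def clip_def abs_le_iff power2_eq_square algebra_simps)

lemma huber_eq_clip: "0 \<le> R \<Longrightarrow> huber R x = 2 * clip R x * x - (clip R x)\<^sup>2"
  by (auto simp: huber_def clip_def power2_eq_square abs_if max_def min_def)

lemma huber_tangent_le:
  assumes "0 \<le> R"
  shows "2 * clip R x * (y - x) \<le> huber R y - huber R x"
proof -
  text \<open>\<^term>\<open>huber R y\<close> is the maximum of \<open>2 c y - c\<^sup>2\<close> over \<open>\<bar>c\<bar> \<le> R\<close>, attained at \<^term>\<open>clip R y\<close>.\<close>
  have "2 * c * y - c\<^sup>2 \<le> 2 * clip R y * y - (clip R y)\<^sup>2" if c: "\<bar>c\<bar> \<le> R" for c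
  proof -
    \<comment> \<open>The difference of the two sides factors in this way. For
      \<open>\<bar>y\<bar> \<le> R\<close> the product is \<open>(y - c)\<^sup>2\<close>; otherwise
      neither factor has the sign opposite to \<open>y\<close>.\<close>
    have "0 \<le> (clip R y - c) * (2 * y - clip R y - c)"
      using c by (auto simp: clip_def max_def min_def zero_le_mult_iff abs_le_iff)
    then show ?thesis
      by (simp add: power2_eq_square algebra_simps)
  qed
  from this[OF abs_clip_le[OF assms]] show ?thesis
    by (simp add: huber_eq_clip[OF assms] algebra_simps)
qed

section \<open>Convergence of uniformly integrable continuous martingales\<close>

locale ui_continuous_martingale = prob_space P
  for P :: "'a measure" +
  fixes F :: "real \<Rightarrow> 'a measure" and M :: "real \<Rightarrow> 'a \<Rightarrow> real"
  assumes filtration: "is_filtration P F"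
    and martingale: "is_martingale P F M"
    and continuous: "continuous_paths P M"
    and uniformly_integrable: "uniformly_integrable_on P {0..} M"
begin

lemma subalgebra_F: "0 \<le> t \<Longrightarrow> subalgebra P (F t)"
  using filtration by (simp add: is_filtration_def)

lemma subalgebra_F_F: "0 \<le> s \<Longrightarrow> s \<le> t \<Longrightarrow> subalgebra (F t) (F s)"
  using filtration by (simp add: is_filtration_def)

lemma adapted: "0 \<le> s \<Longrightarrow> s \<le> t \<Longrightarrow> M s \<in> borel_measurable (F t)"
  using martingale measurable_from_subalg[OF subalgebra_F_F[of s t], of "M s" borel]
  by (simp add: is_martingale_def)

lemma integrable_M [simp]: "0 \<le> t \<Longrightarrow> integrable P (M t)"
  using martingale by (simp add: is_martingale_def)

lemma measurable_M [measurable]: "0 \<le> t \<Longrightarrow> M t \<in> borel_measurable P"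
  by (simp add: borel_measurable_integrable)

lemma continuous_path: "\<omega> \<in> space P \<Longrightarrow> continuous_on {0..} (\<lambda>t. M t \<omega>)"
  using continuous by (simp add: continuous_paths_def)

section \<open>Martingale increments and uniform integrability\<close>

text \<open>The martingale property in the form used below: increments are orthogonal to bounded
  factors known at time \<open>s\<close>. Boundedness gives integrability of the product without
  second moments. The factors will be a signed first-passage indicator and a tangent slope.\<close>

lemma integral_mult_increment:
  assumes "0 \<le> s" "s \<le> t" and g: "g \<in> borel_measurable (F s)" and bound: "\<And>\<omega>. \<bar>g \<omega>\<bar> \<le> C"
  shows "integrable P (\<lambda>\<omega>. g \<omega> * (M t \<omega> - M s \<omega>))"
    and "(\<integral>\<omega>. g \<omega> * (M t \<omega> - M s \<omega>) \<partial>P) = 0"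
proof -
  interpret S: finite_measure_subalgebra P "F s"
    using subalgebra_F[OF assms(1)] by unfold_locales
  have t: "0 \<le> t" using assms by simp
  have gP [measurable]: "g \<in> borel_measurable P"
    by (rule measurable_from_subalg[OF subalgebra_F[OF assms(1)] g])
  have int: "integrable P (\<lambda>\<omega>. g \<omega> * X \<omega>)" if X: "integrable P X" for X
  proof (rule Bochner_Integration.integrable_bound[of P "\<lambda>\<omega>. C * X \<omega>"])
    show "AE \<omega> in P. norm (g \<omega> * X \<omega>) \<le> norm (C * X \<omega>)"
      using bound by (intro AE_I2) (auto simp: abs_mult intro!: mult_right_mono order_trans[OF bound abs_ge_self])
  qed (use X in auto)
  show "integrable P (\<lambda>\<omega>. g \<omega> * (M t \<omega> - M s \<omega>))"
    by (rule int) (use assms t in auto)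
  have "(\<integral>\<omega>. g \<omega> * M t \<omega> \<partial>P) = (\<integral>\<omega>. g \<omega> * real_cond_exp P (F s) (M t) \<omega> \<partial>P)"
    using S.real_cond_exp_intg(2)[of g "M t"] int g t by simp
  also have "\<dots> = (\<integral>\<omega>. g \<omega> * M s \<omega> \<partial>P)"
  proof (intro integral_cong_AE)
    have "AE \<omega> in P. real_cond_exp P (F s) (M t) \<omega> = M s \<omega>"
      using martingale assms(1,2) by (simp add: is_martingale_def)
    then show "AE \<omega> in P. g \<omega> * real_cond_exp P (F s) (M t) \<omega> = g \<omega> * M s \<omega>"
      by eventually_elim simp
  qed (use assms(1) in measurable)
  finally show "(\<integral>\<omega>. g \<omega> * (M t \<omega> - M s \<omega>) \<partial>P) = 0"
    using int assms t by (simp add: right_diff_distrib)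
qed

text \<open>One cutoff serves all times, and it is expressed with real integrals; it later becomes
  the Huber radius.\<close>

lemma tail_integral_le:
  assumes e: "0 < e"
  obtains c where "0 \<le> c" "\<And>t. 0 \<le> t \<Longrightarrow> (\<integral>\<omega>. (if c < \<bar>M t \<omega>\<bar> then \<bar>M t \<omega>\<bar> else 0) \<partial>P) \<le> e"
proof -
  have "\<forall>\<^sub>F c in at_top. (SUP t\<in>{0..}. \<integral>\<^sup>+\<omega>. ennreal \<bar>M t \<omega>\<bar> * indicator {\<omega>. c < \<bar>M t \<omega>\<bar>} \<omega> \<partial>P) < ennreal e"
    using uniformly_integrable e unfolding uniformly_integrable_on_def
    by (intro order_tendstoD(2)) auto
  then obtain c0 where c0: "\<And>c. c0 \<le> c \<Longrightarrow>
    (SUP t\<in>{0..}. \<integral>\<^sup>+\<omega>. ennreal \<bar>M t \<omega>\<bar> * indicator {\<omega>. c < \<bar>M t \<omega>\<bar>} \<omega> \<partial>P) < ennreal e"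
    by (auto simp: eventually_at_top_linorder)
  define c where "c = max c0 0"
  have "(\<integral>\<omega>. (if c < \<bar>M t \<omega>\<bar> then \<bar>M t \<omega>\<bar> else 0) \<partial>P) \<le> e" if t: "0 \<le> t" for t
  proof -
    have "integrable P (\<lambda>\<omega>. if c < \<bar>M t \<omega>\<bar> then \<bar>M t \<omega>\<bar> else 0)"
      using t by (intro Bochner_Integration.integrable_bound[OF integrable_M[OF t]]) auto
    then have "ennreal (\<integral>\<omega>. (if c < \<bar>M t \<omega>\<bar> then \<bar>M t \<omega>\<bar> else 0) \<partial>P) =
        (\<integral>\<^sup>+\<omega>. ennreal (if c < \<bar>M t \<omega>\<bar> then \<bar>M t \<omega>\<bar> else 0) \<partial>P)"
      by (subst nn_integral_eq_integral) auto
    also have "\<dots> = (\<integral>\<^sup>+\<omega>. ennreal \<bar>M t \<omega>\<bar> * indicator {\<omega>. c < \<bar>M t \<omega>\<bar>} \<omega> \<partial>P)"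
      by (intro nn_integral_cong) (auto simp: indicator_def)
    also have "\<dots> \<le> (SUP t\<in>{0..}. \<integral>\<^sup>+\<omega>. ennreal \<bar>M t \<omega>\<bar> * indicator {\<omega>. c < \<bar>M t \<omega>\<bar>} \<omega> \<partial>P)"
      using t by (intro SUP_upper) auto
    also have "\<dots> \<le> ennreal e"
      using c0[of c] by (simp add: c_def)
    finally show ?thesis
      using e by (simp add: ennreal_le_iff)
  qed
  then show thesis
    by (intro that[of c]) (auto simp: c_def)
qed

lemma integral_abs_bounded:
  obtains C where "\<And>t. 0 \<le> t \<Longrightarrow> (\<integral>\<omega>. \<bar>M t \<omega>\<bar> \<partial>P) \<le> C"
proof -
  obtain c where c: "0 \<le> c" "\<And>t. 0 \<le> t \<Longrightarrow> (\<integral>\<omega>. (if c < \<bar>M t \<omega>\<bar> then \<bar>M t \<omega>\<bar> else 0) \<partial>P) \<le> 1"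
    using tail_integral_le[of 1] by auto
  have "(\<integral>\<omega>. \<bar>M t \<omega>\<bar> \<partial>P) \<le> c + 1" if t: "0 \<le> t" for t
  proof -
    have int: "integrable P (\<lambda>\<omega>. if c < \<bar>M t \<omega>\<bar> then \<bar>M t \<omega>\<bar> else 0)"
      using t by (intro Bochner_Integration.integrable_bound[OF integrable_M[OF t]]) auto
    have "(\<integral>\<omega>. \<bar>M t \<omega>\<bar> \<partial>P) \<le> (\<integral>\<omega>. c + (if c < \<bar>M t \<omega>\<bar> then \<bar>M t \<omega>\<bar> else 0) \<partial>P)"
      using c(1) int t by (intro integral_mono) auto
    also have "\<dots> = c + (\<integral>\<omega>. (if c < \<bar>M t \<omega>\<bar> then \<bar>M t \<omega>\<bar> else 0) \<partial>P)"
      using int by (subst Bochner_Integration.integral_add) (auto simp: prob_space)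
    finally show ?thesis
      using c(2)[OF t] by simp
  qed
  then show thesis by (rule that)
qed

section \<open>Doob's maximal inequality for increments\<close>

lemma maximal_inequality_finite:
  assumes s: "0 \<le> s" and S: "finite S" "S \<subseteq> {s..t}" and l: "0 < l"
  shows "l * prob {\<omega> \<in> space P. \<exists>q\<in>S. l \<le> \<bar>M q \<omega> - M s \<omega>\<bar>} \<le> (\<integral>\<omega>. \<bar>M t \<omega> - M s \<omega>\<bar> \<partial>P)"
proof (cases "S = {}")
  case False
  then have t: "s \<le> t" "0 \<le> t" using S s by auto
  define D where "D q \<omega> = M q \<omega> - M s \<omega>" for q \<omega>
  \<comment> \<open>\<open>A q\<close> says that \<open>q\<close> is the first time in
    \<open>S\<close> at which the increment reaches size \<open>l\<close>. This is decided by time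
    \<open>q\<close>, and the events are disjoint, so their contributions add up to at most one
    integral of \<open>\<bar>D t\<bar>\<close>.\<close>
  define A where "A q = {\<omega> \<in> space P. l \<le> \<bar>D q \<omega>\<bar> \<and> (\<forall>r\<in>{r\<in>S. r < q}. \<bar>D r \<omega>\<bar> < l)}" for q
  have spaceF: "space (F q) = space P" if "q \<in> S" for q
    using subalgebra_F[of q] that S s by (auto simp: subalgebra_def)
  have D_F [measurable]: "D r \<in> borel_measurable (F q)" if "s \<le> r" "r \<le> q" for r q
    using adapted[of r q] adapted[of s q] that s unfolding D_def by (intro borel_measurable_diff) auto
  have A_F: "A q \<in> sets (F q)" if q: "q \<in> S" for q
  proof -
    have "{\<omega> \<in> space (F q). l \<le> \<bar>D q \<omega>\<bar> \<and> (\<forall>r\<in>{r\<in>S. r < q}. \<bar>D r \<omega>\<bar> < l)} \<in> sets (F q)"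
    proof (intro sets.sets_Collect_conj sets.sets_Collect_finite_All)
      have [measurable]: "D q \<in> borel_measurable (F q)"
        using q S by (intro D_F) auto
      show "{\<omega> \<in> space (F q). l \<le> \<bar>D q \<omega>\<bar>} \<in> sets (F q)" by measurable
    next
      fix r assume "r \<in> {r \<in> S. r < q}"
      then have [measurable]: "D r \<in> borel_measurable (F q)"
        using S by (intro D_F) auto
      show "{\<omega> \<in> space (F q). \<bar>D r \<omega>\<bar> < l} \<in> sets (F q)" by measurable
    qed (use S in auto)
    then show ?thesis
      using spaceF[OF q] by (simp add: A_def)
  qed
  have A_P [measurable]: "A q \<in> sets P" if "q \<in> S" for q
    using A_F[OF that] subalgebra_F[of q] that S s unfolding subalgebra_def by fastforce
  have int_D [simp]: "integrable P (D q)" if "s \<le> q" for q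
    using that s unfolding D_def by (intro Bochner_Integration.integrable_diff) auto
  have disj: "disjoint_family_on A S"
    unfolding disjoint_family_on_def A_def by (force dest: linorder_neqE)
  have union: "{\<omega> \<in> space P. \<exists>q\<in>S. l \<le> \<bar>M q \<omega> - M s \<omega>\<bar>} \<subseteq> (\<Union>q\<in>S. A q)"
  proof
    fix \<omega> assume w: "\<omega> \<in> {\<omega> \<in> space P. \<exists>q\<in>S. l \<le> \<bar>M q \<omega> - M s \<omega>\<bar>}"
    let ?B = "{q\<in>S. l \<le> \<bar>D q \<omega>\<bar>}"
    have B: "finite ?B" "?B \<noteq> {}"
      using w S by (auto simp: D_def)
    have "\<omega> \<in> A (Min ?B)"
      using Min_in[OF B] w Min_le[OF B(1)] unfolding A_def by force
    then show "\<omega> \<in> (\<Union>q\<in>S. A q)"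
      using Min_in[OF B] by blast
  qed
  have each: "l * prob (A q) \<le> (\<integral>\<omega>. indicator (A q) \<omega> * \<bar>D t \<omega>\<bar> \<partial>P)" if q: "q \<in> S" for q
  proof -
    have sq: "s \<le> q" "q \<le> t" "0 \<le> q" using q S s by auto
    define g where "g \<omega> = indicator (A q) \<omega> * sgn (D q \<omega>)" for \<omega>
    have g_F: "g \<in> borel_measurable (F q)"
      using A_F[OF q] D_F[OF sq(1), of q] unfolding g_def by measurable
    have g_bound: "\<bar>g \<omega>\<bar> \<le> 1" for \<omega>
      by (auto simp: g_def indicator_def sgn_if)
    note zero = integral_mult_increment[OF sq(3,2) g_F g_bound]
    have [measurable]: "A q \<in> sets P" using q by simp
    have intA: "integrable P (\<lambda>\<omega>. indicator (A q) \<omega> * X \<omega>)" if "integrable P X" for X :: "'a \<Rightarrow> real"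
      using integrable_mult_indicator[of "A q" P X] that by simp
    have "l * prob (A q) = (\<integral>\<omega>. indicator (A q) \<omega> * l \<partial>P)"
      using q by simp
    also have "\<dots> \<le> (\<integral>\<omega>. indicator (A q) \<omega> * \<bar>D q \<omega>\<bar> \<partial>P)"
      using sq by (intro integral_mono intA) (auto simp: A_def indicator_def)
    \<comment> \<open>The added term has mean zero. On \<open>A q\<close> it completes
      \<open>\<bar>D q\<bar>\<close> to \<open>sgn (D q) * D t\<close>, which is at most
      \<open>\<bar>D t\<bar>\<close>.\<close>
    also have "\<dots> = (\<integral>\<omega>. indicator (A q) \<omega> * \<bar>D q \<omega>\<bar> + g \<omega> * (M t \<omega> - M q \<omega>) \<partial>P)"
      using zero sq intA by (subst Bochner_Integration.integral_add) auto
    also have "\<dots> \<le> (\<integral>\<omega>. indicator (A q) \<omega> * \<bar>D t \<omega>\<bar> \<partial>P)"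
    proof (intro integral_mono Bochner_Integration.integrable_add intA zero)
      fix \<omega>
      show "indicator (A q) \<omega> * \<bar>D q \<omega>\<bar> + g \<omega> * (M t \<omega> - M q \<omega>) \<le> indicator (A q) \<omega> * \<bar>D t \<omega>\<bar>"
        by (auto simp: g_def D_def indicator_def sgn_if)
    qed (use sq t in auto)
    finally show ?thesis .
  qed
  have "prob {\<omega> \<in> space P. \<exists>q\<in>S. l \<le> \<bar>M q \<omega> - M s \<omega>\<bar>} \<le> prob (\<Union>q\<in>S. A q)"
    using union S by (intro finite_measure_mono sets.finite_UN) auto
  also have "\<dots> \<le> (\<Sum>q\<in>S. prob (A q))"
    using S by (intro finite_measure_subadditive_finite) auto
  finally have "l * prob {\<omega> \<in> space P. \<exists>q\<in>S. l \<le> \<bar>M q \<omega> - M s \<omega>\<bar>} \<le> l * (\<Sum>q\<in>S. prob (A q))"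
    using l by (intro mult_left_mono) auto
  also have "\<dots> \<le> (\<Sum>q\<in>S. \<integral>\<omega>. indicator (A q) \<omega> * \<bar>D t \<omega>\<bar> \<partial>P)"
    using each by (simp add: sum_distrib_left sum_mono)
  also have "\<dots> = (\<integral>\<omega>. (\<Sum>q\<in>S. indicator (A q) \<omega> * \<bar>D t \<omega>\<bar>) \<partial>P)"
    using integrable_mult_indicator[of _ P "\<lambda>\<omega>. \<bar>D t \<omega>\<bar>"] t
    by (subst Bochner_Integration.integral_sum) auto
  also have "\<dots> = (\<integral>\<omega>. indicator (\<Union>q\<in>S. A q) \<omega> * \<bar>D t \<omega>\<bar> \<partial>P)"
    by (simp add: indicator_UN_disjoint[OF S(1) disj] sum_distrib_right)
  also have "\<dots> \<le> (\<integral>\<omega>. \<bar>D t \<omega>\<bar> \<partial>P)"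
    using t S by (intro integral_mono integrable_mult_indicator[where 'b=real, simplified])
      (auto simp: indicator_def intro!: sets.finite_UN)
  finally show ?thesis by (simp add: D_def)
qed simp

text \<open>The rationals are exhausted by finite sets, and continuity of the measure from below
  passes to the limit. The last time of these sets keeps moving, hence a bound \<open>e\<close>
  uniform in \<open>t\<close>.\<close>

lemma maximal_inequality:
  assumes s: "0 \<le> s" and l: "0 < l"
    and e: "\<And>t. s \<le> t \<Longrightarrow> (\<integral>\<omega>. \<bar>M t \<omega> - M s \<omega>\<bar> \<partial>P) \<le> e"
  shows "l * prob {\<omega> \<in> space P. \<exists>q\<in>\<rat>. s \<le> q \<and> l \<le> \<bar>M q \<omega> - M s \<omega>\<bar>} \<le> e"
proof -
  define Q where "Q = \<rat> \<inter> {s..}"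
  obtain q0 where "q0 \<in> \<rat>" "s < q0"
    using Rats_dense_in_real[of s "s + 1"] by auto
  then have Q: "Q \<noteq> {}" "countable Q"
    by (auto simp: Q_def countable_rat)
  define h where "h = from_nat_into Q"
  have h: "range h = Q"
    using Q by (simp add: h_def)
  define B where "B n = {\<omega> \<in> space P. \<exists>q\<in>h ` {..n}. l \<le> \<bar>M q \<omega> - M s \<omega>\<bar>}" for n :: nat
  have hs: "s \<le> h n" for n
    using h by (auto simp: Q_def)
  have "B n \<in> sets P" for n
  proof -
    have [measurable]: "M (h i) \<in> borel_measurable P" "M s \<in> borel_measurable P" for i
      using hs[of i] s by auto
    have "B n = {\<omega> \<in> space P. \<exists>i\<in>{..n}. l \<le> \<bar>M (h i) \<omega> - M s \<omega>\<bar>}"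
      by (auto simp: B_def)
    also have "\<dots> \<in> sets P" by measurable
    finally show ?thesis .
  qed
  moreover have "incseq B"
    by (force simp: incseq_def B_def)
  ultimately have "(\<lambda>n. prob (B n)) \<longlonglongrightarrow> prob (\<Union>n. B n)"
    by (intro finite_Lim_measure_incseq) auto
  then have lim: "(\<lambda>n. l * prob (B n)) \<longlonglongrightarrow> l * prob (\<Union>n. B n)"
    by (rule tendsto_mult_left)
  have "l * prob (B n) \<le> e" for n
  proof -
    let ?t = "Max (h ` {..n})"
    have "s \<le> ?t"
      using hs[of 0] by (rule order_trans) (auto intro: Max_ge)
    moreover have "h ` {..n} \<subseteq> {s..?t}"
      using hs by (auto intro: Max_ge)
    ultimately show ?thesis
      using maximal_inequality_finite[OF s _ _ l, of "h ` {..n}" ?t] e[of ?t] by (simp add: B_def)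
  qed
  then have "l * prob (\<Union>n. B n) \<le> e"
    by (intro LIMSEQ_le_const2[OF lim]) auto
  also have "(\<Union>n. B n) = {\<omega> \<in> space P. \<exists>q\<in>Q. l \<le> \<bar>M q \<omega> - M s \<omega>\<bar>}"
    unfolding B_def h[symmetric] by auto
  finally show ?thesis
    by (simp add: Q_def Bex_def conj_assoc)
qed

text \<open>
  The expectations of \<^term>\<open>\<lambda>\<omega>. huber R (M t \<omega>)\<close> increase to a finite limit, and their increments
  control the increments of \<^term>\<open>M\<close> quadratically where \<^term>\<open>M\<close> stays below \<open>R\<close>.
\<close>

lemma L1_Cauchy:
  assumes e: "0 < e"
  obtains s0 where "0 \<le> s0" "\<And>s t. s0 \<le> s \<Longrightarrow> s \<le> t \<Longrightarrow> (\<integral>\<omega>. \<bar>M t \<omega> - M s \<omega>\<bar> \<partial>P) \<le> e"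
proof -
  obtain R where R: "0 \<le> R" and
    tail: "\<And>t. 0 \<le> t \<Longrightarrow> (\<integral>\<omega>. (if R < \<bar>M t \<omega>\<bar> then \<bar>M t \<omega>\<bar> else 0) \<partial>P) \<le> e / 8"
    using tail_integral_le[of "e / 8"] e by auto
  obtain C where C: "\<And>t. 0 \<le> t \<Longrightarrow> (\<integral>\<omega>. \<bar>M t \<omega>\<bar> \<partial>P) \<le> C"
    using integral_abs_bounded by blast
  define \<tau> where "\<tau> x = (if R < \<bar>x\<bar> then \<bar>x\<bar> else 0)" for x :: real
  define a where "a t = (\<integral>\<omega>. huber R (M t \<omega>) \<partial>P)" for t
  \<comment> \<open>The gap between \<open>huber R\<close> and its tangent at \<open>x\<close>.
    Along the martingale the linear term integrates to zero, so the mean of the gap is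
    \<open>a t - a s\<close>.\<close>
  define B where "B x y = huber R y - huber R x - 2 * clip R x * (y - x)" for x y
  have int_\<tau> [simp]: "integrable P (\<lambda>\<omega>. \<tau> (M t \<omega>))" if t: "0 \<le> t" for t
    using t unfolding \<tau>_def by (intro Bochner_Integration.integrable_bound[OF integrable_M[OF t]]) auto
  have int_h [simp]: "integrable P (\<lambda>\<omega>. huber R (M t \<omega>))" if t: "0 \<le> t" for t
  proof (rule Bochner_Integration.integrable_bound[of P "\<lambda>\<omega>. 2 * R * M t \<omega>"])
    show "AE \<omega> in P. norm (huber R (M t \<omega>)) \<le> norm (2 * R * M t \<omega>)"
      using R by (auto simp: abs_mult huber_nonneg huber_le)
  qed (use t in auto)
  have B_int: "integrable P (\<lambda>\<omega>. B (M s \<omega>) (M t \<omega>))" "(\<integral>\<omega>. B (M s \<omega>) (M t \<omega>) \<partial>P) = a t - a s"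
    if st: "0 \<le> s" "s \<le> t" for s t
  proof -
    have "(\<lambda>\<omega>. clip R (M s \<omega>)) \<in> borel_measurable (F s)"
      using adapted[of s s] st(1) by measurable
    then have "(\<lambda>\<omega>. 2 * clip R (M s \<omega>)) \<in> borel_measurable (F s)"
      by (rule borel_measurable_times[OF borel_measurable_const])
    moreover have "\<bar>2 * clip R (M s \<omega>)\<bar> \<le> 2 * R" for \<omega>
      using abs_clip_le[OF R] by (simp add: abs_mult)
    ultimately have "integrable P (\<lambda>\<omega>. 2 * clip R (M s \<omega>) * (M t \<omega> - M s \<omega>))"
      "(\<integral>\<omega>. 2 * clip R (M s \<omega>) * (M t \<omega> - M s \<omega>) \<partial>P) = 0"
      by (rule integral_mult_increment[OF st])+
    then show "integrable P (\<lambda>\<omega>. B (M s \<omega>) (M t \<omega>))" "(\<integral>\<omega>. B (M s \<omega>) (M t \<omega>) \<partial>P) = a t - a s"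
      using st unfolding B_def a_def by auto
  qed
  have B_nonneg: "0 \<le> B x y" for x y
    using huber_tangent_le[OF R, of x y] by (simp add: B_def)
  have a_mono: "a s \<le> a t" if "0 \<le> s" "s \<le> t" for s t
    using integral_nonneg_AE[of "\<lambda>\<omega>. B (M s \<omega>) (M t \<omega>)" P] B_int[OF that] B_nonneg by simp
  have "a t \<le> 2 * R * C" if t: "0 \<le> t" for t
  proof -
    have "a t \<le> (\<integral>\<omega>. 2 * R * \<bar>M t \<omega>\<bar> \<partial>P)"
      unfolding a_def using t R by (intro integral_mono) (auto simp: huber_le)
    also have "\<dots> \<le> 2 * R * C"
      using C[OF t] R by (simp add: mult_left_mono)
    finally show ?thesis .
  qed
  then have bdd: "bdd_above (a ` {0..})"
    by (auto intro!: bdd_aboveI)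
  \<comment> \<open>The margin \<open>e\<^sup>2 / 16\<close> becomes \<open>e / 4\<close> after the
    factor \<open>4 / e\<close> below. The constant term and the two tails, each at most
    \<open>e / 8\<close> and counted twice, supply the other three quarters.\<close>
  have "(SUP t\<in>{0..}. a t) - e\<^sup>2 / 16 < (SUP t\<in>{0..}. a t)"
    using e by simp
  then obtain s0 where s0: "0 \<le> s0" "(SUP t\<in>{0..}. a t) - e\<^sup>2 / 16 < a s0"
    using less_cSUP_iff[OF _ bdd] by fastforce
  have incr: "a t - a s \<le> e\<^sup>2 / 16" if "s0 \<le> s" "s \<le> t" for s t
    using cSUP_upper[OF _ bdd, of t] a_mono[of s0 s] s0 that by auto
  \<comment> \<open>Inside the quadratic region this is Young's inequality. Otherwise the larger of
    the two moduli exceeds \<open>R\<close>, and twice its tail term already bounds the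
    distance.\<close>
  have pointwise: "\<bar>y - x\<bar> \<le> e / 4 + 4 / e * B x y + 2 * \<tau> y + 2 * \<tau> x" for x y
  proof (cases "\<bar>x\<bar> \<le> R \<and> \<bar>y\<bar> \<le> R")
    case True
    have "0 \<le> (2 * \<bar>y - x\<bar> - e / 4)\<^sup>2" "0 \<le> e\<^sup>2"
      by simp_all
    moreover have "(2 * \<bar>y - x\<bar> - e / 4)\<^sup>2 = 4 * (y - x)\<^sup>2 - e * \<bar>y - x\<bar> + e\<^sup>2 / 16"
      unfolding power2_diff power_mult_distrib power2_abs by (simp add: power_divide)
    ultimately have "e * \<bar>y - x\<bar> \<le> e\<^sup>2 / 4 + 4 * (y - x)\<^sup>2"
      by linarith
    then have "\<bar>y - x\<bar> \<le> e / 4 + 4 / e * (y - x)\<^sup>2"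
      using e by (simp add: field_simps power2_eq_square)
    moreover have "B x y = (y - x)\<^sup>2"
      using huber_tangent_eq[of x R y] True by (simp add: B_def)
    ultimately show ?thesis
      using True by (simp add: \<tau>_def)
  next
    case False
    have "0 \<le> 4 / e * B x y"
      using B_nonneg e by simp
    then show ?thesis
      using False e by (auto simp: \<tau>_def)
  qed
  have "(\<integral>\<omega>. \<bar>M t \<omega> - M s \<omega>\<bar> \<partial>P) \<le> e" if st: "s0 \<le> s" "s \<le> t" for s t
  proof -
    have st0: "0 \<le> s" "0 \<le> t" using s0 st by auto
    have "(\<integral>\<omega>. \<bar>M t \<omega> - M s \<omega>\<bar> \<partial>P)
      \<le> (\<integral>\<omega>. e / 4 + 4 / e * B (M s \<omega>) (M t \<omega>) + 2 * \<tau> (M t \<omega>) + 2 * \<tau> (M s \<omega>) \<partial>P)"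
      using pointwise B_int[OF st0(1) st(2)] st0 by (intro integral_mono) auto
    also have "\<dots> = e / 4 + 4 / e * (a t - a s) + 2 * (\<integral>\<omega>. \<tau> (M t \<omega>) \<partial>P) + 2 * (\<integral>\<omega>. \<tau> (M s \<omega>) \<partial>P)"
      using B_int[OF st0(1) st(2)] st0 by (simp add: prob_space)
    also have "\<dots> \<le> e / 4 + 4 / e * (e\<^sup>2 / 16) + 2 * (e / 8) + 2 * (e / 8)"
      using tail[OF st0(1)] tail[OF st0(2)] incr[OF st] e unfolding \<tau>_def
      by (intro add_mono mult_left_mono) auto
    also have "\<dots> = e"
      using e by (simp add: power2_eq_square field_simps)
    finally show ?thesis .
  qed
  then show thesis
    using s0(1) that by blast
qed

section \<open>Almost sure convergence and the limit variable\<close>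

lemma AE_convergent: "AE \<omega> in P. \<exists>l. ((\<lambda>t. M t \<omega>) \<longlongrightarrow> l) at_top"
proof -
  \<comment> \<open>A divergent path violates the rational Cauchy criterion: for some
    \<open>k\<close> it lies in \<open>Bad k n\<close> for every \<open>n\<close>.\<close>
  define Bad where "Bad k n = {\<omega> \<in> space P. \<exists>q\<in>\<rat> \<inter> {real n..}. 1 / real (Suc k) \<le> \<bar>M q \<omega> - M (real n) \<omega>\<bar>}"
    for k n :: nat
  have Bad_sets [measurable]: "Bad k n \<in> sets P" for k n
    unfolding Bad_def
  proof (rule sets.sets_Collect_countable_Ex')
    fix q assume "q \<in> \<rat> \<inter> {real n..}"
    then have [measurable]: "M q \<in> borel_measurable P" "M (real n) \<in> borel_measurable P"
      by (auto intro: measurable_M order_trans[OF of_nat_0_le_iff])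
    show "{\<omega> \<in> space P. 1 / real (Suc k) \<le> \<bar>M q \<omega> - M (real n) \<omega>\<bar>} \<in> sets P"
      by measurable
  qed (simp add: countable_rat)
  have "AE \<omega> in P. \<omega> \<notin> (\<Inter>n. Bad k n)" for k
  proof (rule AE_not_in)
    have "prob (\<Inter>n. Bad k n) \<le> 0 + e" if e: "0 < e" for e
    proof -
      let ?l = "1 / real (Suc k)"
      \<comment> \<open>Asking for L1 distance \<open>?l * e\<close> cancels the factor
        \<open>?l\<close> in the maximal inequality and leaves probability at most
        \<open>e\<close>.\<close>
      have "0 < ?l * e" using e by simp
      then obtain s0 where s0: "0 \<le> s0"
        "\<And>s t. s0 \<le> s \<Longrightarrow> s \<le> t \<Longrightarrow> (\<integral>\<omega>. \<bar>M t \<omega> - M s \<omega>\<bar> \<partial>P) \<le> ?l * e"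
        by (rule L1_Cauchy) (use that in blast)
      obtain n :: nat where n: "s0 \<le> real n"
        using real_arch_simple by blast
      have "prob (\<Inter>n. Bad k n) \<le> prob (Bad k n)"
        by (intro finite_measure_mono) auto
      moreover have "?l * prob (Bad k n) \<le> ?l * e"
        using maximal_inequality[of "real n" ?l "?l * e"] s0(2)[OF n]
        by (simp add: Bad_def Bex_def conj_assoc)
      ultimately show ?thesis
        by (simp add: divide_le_cancel)
    qed
    then have "prob (\<Inter>n. Bad k n) = 0"
      using field_le_epsilon measure_nonneg by (metis order_antisym)
    then show "(\<Inter>n. Bad k n) \<in> null_sets P"
      by (simp add: emeasure_eq_measure null_sets_def)
  qed
  then have "AE \<omega> in P. \<forall>k. \<omega> \<notin> (\<Inter>n. Bad k n)"
    by (simp add: AE_all_countable)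
  then show ?thesis
    using AE_space
  proof eventually_elim
    case (elim \<omega>)
    show ?case
      unfolding continuous_on_tendsto_at_top_iff_rational[OF continuous_path[OF elim(2)]]
    proof
      fix k
      obtain n where "\<omega> \<notin> Bad k n" using elim(1) by blast
      then have "\<bar>M q \<omega> - M (real n) \<omega>\<bar> \<le> 1 / real (Suc k)" if "q \<in> \<rat>" "real n \<le> q" for q
        using elim(2) that unfolding Bad_def by (auto simp: not_le intro: less_imp_le)
      then show "\<exists>n::nat. \<forall>q\<in>\<rat> \<inter> {real n..}. \<bar>M q \<omega> - M (real n) \<omega>\<bar> \<le> 1 / real (Suc k)"
        by (intro exI[of _ n]) auto
    qed
  qed
qed

lemma M_inf_eq: "((\<lambda>t. M t \<omega>) \<longlongrightarrow> l) at_top \<Longrightarrow> M_inf M \<omega> = l"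
  unfolding M_inf_def by (rule tendsto_Lim) simp

lemma AE_tendsto_M_inf: "AE \<omega> in P. ((\<lambda>t. M t \<omega>) \<longlongrightarrow> M_inf M \<omega>) at_top"
  using AE_convergent by eventually_elim (use M_inf_eq in blast)

lemma M_inf_measurable [measurable]: "M_inf M \<in> borel_measurable P"
proof -
  define conv where "conv \<omega> \<longleftrightarrow> (\<exists>l. ((\<lambda>t. M t \<omega>) \<longlongrightarrow> l) at_top)" for \<omega>
  have "{\<omega> \<in> space P. conv \<omega>} = {\<omega> \<in> space P. \<forall>k::nat. \<exists>n::nat. \<forall>q\<in>\<rat> \<inter> {real n..}.
      \<bar>M q \<omega> - M (real n) \<omega>\<bar> \<le> 1 / real (Suc k)}"
    using continuous_on_tendsto_at_top_iff_rational[OF continuous_path] unfolding conv_def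
    by (intro Collect_cong conj_cong refl)
  also have "\<dots> \<in> sets P"
  proof (intro sets.sets_Collect_countable_All sets.sets_Collect_countable_Ex sets.sets_Collect_countable_All')
    fix k n :: nat and q assume "q \<in> \<rat> \<inter> {real n..}"
    then have [measurable]: "M q \<in> borel_measurable P" "M (real n) \<in> borel_measurable P"
      by (auto intro: measurable_M order_trans[OF of_nat_0_le_iff])
    show "{\<omega> \<in> space P. \<bar>M q \<omega> - M (real n) \<omega>\<bar> \<le> 1 / real (Suc k)} \<in> sets P"
      by measurable
  qed (simp add: countable_rat)
  finally have [measurable]: "{\<omega> \<in> space P. conv \<omega>} \<in> sets P" .
  have [measurable]: "M (real n) \<in> borel_measurable P" for n
    by (simp add: measurable_M)
  \<comment> \<open>On a divergent path the description defining \<open>Lim\<close> is satisfied by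
    no \<open>l\<close>, so it collapses to the single constant \<open>THE l. False\<close>.\<close>
  have "M_inf M \<omega> = (if conv \<omega> then lim (\<lambda>n. M (real n) \<omega>) else (THE l. False))" for \<omega>
  proof (cases "conv \<omega>")
    case True
    then obtain l where l: "((\<lambda>t. M t \<omega>) \<longlongrightarrow> l) at_top"
      by (auto simp: conv_def)
    then have "(\<lambda>n. M (real n) \<omega>) \<longlonglongrightarrow> l"
      by (rule filterlim_compose[OF _ filterlim_real_sequentially])
    then show ?thesis
      using True l by (simp add: M_inf_eq limI)
  next
    case False
    then show ?thesis
      by (simp add: M_inf_def t2_space_class.Lim_def conv_def)
  qed
  then have "M_inf M = (\<lambda>\<omega>. if conv \<omega> then lim (\<lambda>n. M (real n) \<omega>) else (THE l. False))"
    by blast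
  also have "\<dots> \<in> borel_measurable P"
    by measurable
  finally show ?thesis .
qed

lemma M_inf_integrable [simp]: "integrable P (M_inf M)"
proof (rule integrableI_bounded)
  obtain C where C: "\<And>t. 0 \<le> t \<Longrightarrow> (\<integral>\<omega>. \<bar>M t \<omega>\<bar> \<partial>P) \<le> C"
    using integral_abs_bounded by blast
  have [measurable]: "M (real n) \<in> borel_measurable P" for n
    by (simp add: measurable_M)
  have "(\<integral>\<^sup>+\<omega>. ennreal (norm (M_inf M \<omega>)) \<partial>P) = (\<integral>\<^sup>+\<omega>. liminf (\<lambda>n. ennreal (norm (M (real n) \<omega>))) \<partial>P)"
  proof (rule nn_integral_cong_AE)
    show "AE \<omega> in P. ennreal (norm (M_inf M \<omega>)) = liminf (\<lambda>n. ennreal (norm (M (real n) \<omega>)))"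
      using AE_tendsto_M_inf
    proof eventually_elim
      case (elim \<omega>)
      have "(\<lambda>n. M (real n) \<omega>) \<longlonglongrightarrow> M_inf M \<omega>"
        by (rule filterlim_compose[OF elim filterlim_real_sequentially])
      then have "(\<lambda>n. ennreal (norm (M (real n) \<omega>))) \<longlonglongrightarrow> ennreal (norm (M_inf M \<omega>))"
        by (intro tendsto_ennrealI tendsto_norm)
      then show ?case
        by (intro lim_imp_Liminf[symmetric]) auto
    qed
  qed
  also have "\<dots> \<le> liminf (\<lambda>n. \<integral>\<^sup>+\<omega>. ennreal (norm (M (real n) \<omega>)) \<partial>P)"
    by (rule nn_integral_liminf) measurable
  also have "\<dots> \<le> liminf (\<lambda>n::nat. ennreal C)"
  proof (intro Liminf_mono always_eventually allI)
    fix n :: nat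
    have "(\<integral>\<^sup>+\<omega>. ennreal (norm (M (real n) \<omega>)) \<partial>P) = ennreal (\<integral>\<omega>. \<bar>M (real n) \<omega>\<bar> \<partial>P)"
      by (subst nn_integral_eq_integral) auto
    also have "\<dots> \<le> ennreal C"
      by (intro ennreal_leI C) simp
    finally show "(\<integral>\<^sup>+\<omega>. ennreal (norm (M (real n) \<omega>)) \<partial>P) \<le> ennreal C" .
  qed
  also have "\<dots> < \<infinity>"
    by (simp add: Liminf_const)
  finally show "(\<integral>\<^sup>+\<omega>. ennreal (norm (M_inf M \<omega>)) \<partial>P) < \<infinity>" .
qed measurable

end

section \<open>Hitting times and pathwise inequalities\<close>

lemma M_at_ennreal: "0 \<le> t \<Longrightarrow> M_at M (ennreal t) \<omega> = M t \<omega>"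
  by (simp add: M_at_def)

text \<open>Time infinity may belong to the set defining \<open>hitting\<close>, but it is never
  strictly below \<open>y\<close>, so only finite times count.\<close>

lemma hitting_less_iff:
  "hitting M x \<omega> < y \<longleftrightarrow> (\<exists>t\<ge>0. ennreal t < y \<and> M t \<omega> = x)"
proof
  assume "hitting M x \<omega> < y"
  then obtain t where t: "M_at M t \<omega> = x" "t < y"
    by (auto simp: hitting_def Inf_less_iff)
  then obtain r where "0 \<le> r" "t = ennreal r"
    by (cases t) auto
  then show "\<exists>t\<ge>0. ennreal t < y \<and> M t \<omega> = x"
    using t by (auto simp: M_at_ennreal)
next
  assume "\<exists>t\<ge>0. ennreal t < y \<and> M t \<omega> = x"
  then obtain t where "0 \<le> t" "ennreal t < y" "M t \<omega> = x"
    by blast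
  then show "hitting M x \<omega> < y"
    unfolding hitting_def Inf_less_iff by (intro bexI[of _ "ennreal t"]) (auto simp: M_at_ennreal)
qed

lemma hitting_finite_iff: "hitting M x \<omega> < \<top> \<longleftrightarrow> (\<exists>t\<ge>0. M t \<omega> = x)"
  by (simp add: hitting_less_iff)

text \<open>The set of finite hitting times is closed by continuity, so it contains its
  infimum.\<close>

lemma hitting_attained:
  assumes cont: "continuous_on {0..} (\<lambda>t. M t \<omega>)" and fin: "hitting M x \<omega> < \<infinity>"
  obtains t where "0 \<le> t" "hitting M x \<omega> = ennreal t" "M t \<omega> = x"
proof -
  define T where "T = {t \<in> {0..}. M t \<omega> = x}"
  have "T \<noteq> {}"
    using fin by (auto simp: hitting_finite_iff T_def)
  moreover have "closed T"
  proof -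
    have "closed ({0..} \<inter> (\<lambda>t. M t \<omega>) -` {x})"
      by (intro continuous_closed_preimage cont) auto
    moreover have "T = {0..} \<inter> (\<lambda>t. M t \<omega>) -` {x}"
      by (auto simp: T_def)
    ultimately show ?thesis by simp
  qed
  moreover have bdd: "bdd_below T"
    by (auto simp: T_def)
  ultimately have t0: "Inf T \<in> T"
    by (intro closed_contains_Inf)
  have "hitting M x \<omega> = ennreal (Inf T)"
    unfolding hitting_def
  proof (rule Inf_eqI)
    fix i assume "i \<in> {t. M_at M t \<omega> = x}"
    then show "ennreal (Inf T) \<le> i"
    proof (cases i)
      case (real r)
      then have "r \<in> T"
        using \<open>i \<in> _\<close> by (simp add: T_def M_at_ennreal)
      then show ?thesis
        unfolding real by (intro ennreal_leI cInf_lower bdd)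
    qed simp
  next
    fix y assume "\<And>i. i \<in> {t. M_at M t \<omega> = x} \<Longrightarrow> y \<le> i"
    then show "y \<le> ennreal (Inf T)"
      using t0 by (simp add: T_def M_at_ennreal)
  qed
  then show thesis
    using t0 that by (auto simp: T_def)
qed

text \<open>Both first times would be attained, and a path has only one value at a time. This
  excludes finite ties, at which both indicators in \<open>G_II\<close> would vanish.\<close>

lemma hitting_neq:
  assumes "continuous_on {0..} (\<lambda>t. M t \<omega>)" "hitting M x \<omega> < \<infinity>" "x \<noteq> y"
  shows "hitting M x \<omega> \<noteq> hitting M y \<omega>"
proof
  assume eq: "hitting M x \<omega> = hitting M y \<omega>"
  obtain s where s: "0 \<le> s" "hitting M x \<omega> = ennreal s" "M s \<omega> = x"
    by (rule hitting_attained[where M = M and \<omega> = \<omega> and x = x, OF assms(1,2)])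
  obtain t where "0 \<le> t" "hitting M y \<omega> = ennreal t" "M t \<omega> = y"
    by (rule hitting_attained[where M = M and \<omega> = \<omega> and x = y, OF assms(1)]) (use assms(2) eq in auto)
  then show False
    using s eq assms(3) by simp
qed

lemma less_of_not_hit:
  fixes f :: "real \<Rightarrow> real"
  assumes "continuous_on {0..} f" "f 0 < x" "\<And>t. 0 \<le> t \<Longrightarrow> f t \<noteq> x" "0 \<le> t"
  shows "f t < x"
proof (rule ccontr)
  assume "\<not> f t < x"
  moreover have "continuous_on {0..t} f"
    by (rule continuous_on_subset[OF assms(1)]) auto
  ultimately obtain s where "0 \<le> s" "f s = x"
    using IVT'[of f 0 x t] assms(2,4) by auto
  then show False using assms(3) by blast
qed

lemma greater_of_not_hit:
  fixes f :: "real \<Rightarrow> real"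
  assumes "continuous_on {0..} f" "x < f 0" "\<And>t. 0 \<le> t \<Longrightarrow> f t \<noteq> x" "0 \<le> t"
  shows "x < f t"
  using less_of_not_hit[of "\<lambda>t. - f t" "- x" t] assms by (auto intro!: continuous_intros)

section \<open>Extrema of a path\<close>

text \<open>Strictness survives the supremum because \<open>[0, \<infinity>]\<close> is compact for
  a convergent path: late values stay below an intermediate \<open>y\<close>, and on the remaining
  interval the maximum is attained.\<close>

lemma M_sup_less:
  assumes cont: "continuous_on {0..} (\<lambda>t. M t \<omega>)"
    and lim: "((\<lambda>t. M t \<omega>) \<longlongrightarrow> M_inf M \<omega>) at_top"
    and less: "\<And>t. 0 \<le> t \<Longrightarrow> M t \<omega> < x" "M_inf M \<omega> < x"
  shows "M_sup M \<omega> < ereal x"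
proof -
  obtain y where y: "M_inf M \<omega> < y" "y < x"
    using dense less(2) by blast
  obtain N0 where N0: "\<And>t. N0 \<le> t \<Longrightarrow> M t \<omega> < y"
    using order_tendstoD(2)[OF lim y(1)] by (auto simp: eventually_at_top_linorder)
  define N where "N = max N0 0"
  have "continuous_on {0..N} (\<lambda>t. M t \<omega>)"
    by (rule continuous_on_subset[OF cont]) auto
  then obtain u where u: "u \<in> {0..N}" "\<And>t. t \<in> {0..N} \<Longrightarrow> M t \<omega> \<le> M u \<omega>"
    using continuous_attains_sup[of "{0..N}" "\<lambda>t. M t \<omega>"] by (auto simp: N_def)
  have "M_at M t \<omega> \<le> max y (M u \<omega>)" for t
  proof (cases t)
    case (real r)
    then show ?thesis
      using N0[of r] u(2)[of r] by (cases "r \<le> N") (auto simp: M_at_ennreal N_def le_max_iff_disj)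
  next
    case top
    then show ?thesis
      using y(1) by (simp add: M_at_def)
  qed
  then have "M_sup M \<omega> \<le> ereal (max y (M u \<omega>))"
    unfolding M_sup_def by (intro SUP_least) (simp only: ereal_less_eq)
  also have "\<dots> < ereal x"
    using y(2) less(1)[of u] u(1) by simp
  finally show ?thesis .
qed

lemma M_sup_ge: "0 \<le> t \<Longrightarrow> ereal (M t \<omega>) \<le> M_sup M \<omega>"
  unfolding M_sup_def by (rule SUP_upper2[of "ennreal t"]) (auto simp: M_at_ennreal)

lemma M_sup_ge_M_inf: "ereal (M_inf M \<omega>) \<le> M_sup M \<omega>"
  unfolding M_sup_def by (rule SUP_upper2[of \<infinity>]) (auto simp: M_at_def)

lemma M_low_le: "0 \<le> t \<Longrightarrow> M_low M \<omega> \<le> ereal (M t \<omega>)"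
  unfolding M_low_def by (rule INF_lower2[of "ennreal t"]) (auto simp: M_at_ennreal)

lemma M_low_le_M_inf: "M_low M \<omega> \<le> ereal (M_inf M \<omega>)"
  unfolding M_low_def by (rule INF_lower2[of \<infinity>]) (auto simp: M_at_def)

text \<open>\<open>M_inf\<close> is kept as a separate term, since on a divergent path it is a
  default value unrelated to the values at finite times.\<close>

lemma M_sup_eq_rational:
  assumes cont: "continuous_on {0..} (\<lambda>t. M t \<omega>)"
  shows "M_sup M \<omega> = max (SUP q\<in>\<rat> \<inter> {0..}. ereal (M q \<omega>)) (ereal (M_inf M \<omega>))"
    (is "_ = max ?S _")
proof (rule antisym)
  have le: "ereal (M t \<omega>) \<le> ?S" if t: "0 \<le> t" for t
  proof (rule ccontr)
    assume "\<not> ereal (M t \<omega>) \<le> ?S"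
    then have "ereal (M t \<omega>) \<in> {?S<..}" by simp
    moreover have "continuous_on {0..} (\<lambda>t. ereal (M t \<omega>))"
      by (intro continuous_on_ereal cont)
    ultimately obtain q where "q \<in> \<rat>" "t < q" "ereal (M q \<omega>) \<in> {?S<..}"
      using continuous_on_rational_right[of 0 "\<lambda>t. ereal (M t \<omega>)" t "t + 1" "{?S<..}"] t by auto
    moreover from this t have "ereal (M q \<omega>) \<le> ?S"
      by (intro SUP_upper) auto
    ultimately show False by simp
  qed
  show "M_sup M \<omega> \<le> max ?S (ereal (M_inf M \<omega>))"
    unfolding M_sup_def
  proof (rule SUP_least)
    fix t :: ennreal
    show "ereal (M_at M t \<omega>) \<le> max ?S (ereal (M_inf M \<omega>))"
    proof (cases t)
      case (real r)
      then show ?thesis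
        using le[of r] by (simp add: M_at_ennreal le_max_iff_disj)
    next
      case top
      then show ?thesis
        by (simp add: M_at_def)
    qed
  qed
  show "max ?S (ereal (M_inf M \<omega>)) \<le> M_sup M \<omega>"
    by (auto intro!: SUP_least M_sup_ge M_sup_ge_M_inf)
qed

section \<open>Pathwise domination by the three payoffs\<close>

lemma G_I_ge:
  assumes bl: "bl < 0" and K: "bl < K"
    and zero: "M 0 \<omega> = 0" and cont: "continuous_on {0..} (\<lambda>t. M t \<omega>)"
    and lim: "((\<lambda>t. M t \<omega>) \<longlongrightarrow> M_inf M \<omega>) at_top"
  shows "of_bool (ereal bl < M_low M \<omega>) \<le> G_I M bl K \<omega>"
proof (cases "hitting M bl \<omega> < \<infinity>")
  case True
  then obtain t where "0 \<le> t" "M t \<omega> = bl"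
    by (auto simp: hitting_finite_iff)
  then have "\<not> ereal bl < M_low M \<omega>"
    using M_low_le[of t M \<omega>] by (simp add: not_less)
  moreover have "0 \<le> G_I M bl K \<omega>"
  proof -
    define m where "m = M_inf M \<omega>"
    have G: "G_I M bl K \<omega> =
        (pos_part (m - K) - pos_part (bl - m) - (m - bl)) / (K - bl) + of_bool (bl < m)"
      using True by (simp add: G_I_def m_def)
    \<comment> \<open>The numerator vanishes up to \<open>bl\<close>, decreases to
      \<open>bl - K\<close> at \<open>K\<close> and is constant afterwards. The quotient is thus at
      least \<open>-1\<close>, and the indicator of \<open>bl < m\<close> compensates it.\<close>
    consider "m \<le> bl" | "bl < m" "m \<le> K" | "K < m"
      by linarith
    then show ?thesis
    proof cases
      case 2
      then have "(bl - m) / (K - bl) \<ge> - 1"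
        by (simp add: pos_le_divide_eq)
      then show ?thesis
        using 2 by (simp add: G pos_part_def)
    next
      case 3
      then have "(bl - K) / (K - bl) = - 1"
        using K by (simp add: divide_eq_minus_1_iff)
      then show ?thesis
        using 3 K by (simp add: G pos_part_def)
    qed (use K in \<open>simp add: G pos_part_def\<close>)
  qed
  ultimately show ?thesis
    by simp
next
  case False
  then have "M t \<omega> \<noteq> bl" if "0 \<le> t" for t
    using that by (auto simp: hitting_finite_iff)
  then have "bl < M t \<omega>" if "0 \<le> t" for t
    using greater_of_not_hit[OF cont, of bl t] bl zero that by auto
  then have "bl \<le> M_inf M \<omega>"
    by (intro tendsto_lowerbound[OF lim])
      (auto simp: eventually_at_top_linorder intro!: exI[of _ 0] less_imp_le)
  \<comment> \<open>A level \<open>bl\<close> that is never hit may still be the limit; the strict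
    bound on \<open>M_low\<close> excludes this and switches on the last indicator of
    \<open>G_I\<close>.\<close>
  moreover have "bl < M_inf M \<omega>" if "ereal bl < M_low M \<omega>"
    using less_le_trans[OF that M_low_le_M_inf] by simp
  ultimately show ?thesis
    using False K by (auto simp: G_I_def pos_part_def)
qed

text \<open>\<open>G_II\<close> is the affine function with value 0 at \<open>bl\<close> and 1 at
  \<open>bu\<close>, evaluated at the path stopped on first reaching either level. The three cases
  are exit at \<open>bl\<close>, exit at \<open>bu\<close>, and no exit.\<close>

lemma G_II_ge:
  assumes bl: "bl < 0" and bu: "0 < bu"
    and zero: "M 0 \<omega> = 0" and cont: "continuous_on {0..} (\<lambda>t. M t \<omega>)"
    and lim: "((\<lambda>t. M t \<omega>) \<longlongrightarrow> M_inf M \<omega>) at_top"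
  shows "of_bool (ereal bu \<le> M_sup M \<omega> \<and> ereal bl < M_low M \<omega>) \<le> G_II M bl bu \<omega>"
proof -
  consider "hitting M bl \<omega> < hitting M bu \<omega>" | "hitting M bu \<omega> < hitting M bl \<omega>"
    | "\<not> hitting M bl \<omega> < \<infinity>" "\<not> hitting M bu \<omega> < \<infinity>"
    using hitting_neq[where M = M and \<omega> = \<omega> and x = bl and y = bu, OF cont] bl bu
    by (cases "hitting M bl \<omega>" "hitting M bu \<omega>" rule: linorder_cases) auto
  then show ?thesis
  proof cases
    case 1
    then have fin: "hitting M bl \<omega> < \<infinity>"
      by (rule less_le_trans) simp
    then obtain t where "0 \<le> t" "M t \<omega> = bl"
      by (auto simp: hitting_finite_iff)
    then have "\<not> ereal bl < M_low M \<omega>"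
      using M_low_le[of t M \<omega>] by (simp add: not_less)
    then show ?thesis
      using 1 fin by (simp add: G_II_def less_not_sym)
  next
    case 2
    then have fin: "hitting M bu \<omega> < \<infinity>"
      by (rule less_le_trans) simp
    have "(M_inf M \<omega> - bl) / (bu - bl) - (M_inf M \<omega> - bu) / (bu - bl) = 1"
      using bl bu by (simp add: diff_divide_distrib[symmetric])
    then show ?thesis
      using 2 fin by (simp add: G_II_def less_not_sym)
  next
    case 3
    have neq: "M t \<omega> \<noteq> bl" "M t \<omega> \<noteq> bu" if "0 \<le> t" for t
      using 3 that by (auto simp: hitting_finite_iff)
    have gt: "bl < M t \<omega>" if "0 \<le> t" for t
      using greater_of_not_hit[OF cont, of bl t] neq bl zero that by auto
    have lt: "M t \<omega> < bu" if "0 \<le> t" for t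
      using less_of_not_hit[OF cont, of bu t] neq bu zero that by auto
    have "bl \<le> M_inf M \<omega>"
      using gt by (intro tendsto_lowerbound[OF lim])
        (auto simp: eventually_at_top_linorder intro!: exI[of _ 0] less_imp_le)
    \<comment> \<open>Without a hit, the supremum can reach \<open>bu\<close> only through the limit
      at infinity.\<close>
    moreover have "bu \<le> M_inf M \<omega>" if "ereal bu \<le> M_sup M \<omega>"
      using M_sup_less[OF cont lim lt] that by (force simp: not_le[symmetric])
    moreover have "G_II M bl bu \<omega> = (M_inf M \<omega> - bl) / (bu - bl)"
      using 3 by (simp add: G_II_def)
    ultimately show ?thesis
      using bl bu by (simp add: of_bool_def)
  qed
qed

text \<open>Once \<open>bu\<close> has been reached, \<open>m - K' \<le> pos_part (m - K')\<close>
  makes the numerator at least \<open>bu - K'\<close>; otherwise it is nonnegative. The argument is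
  algebraic and holds on every path.\<close>

lemma G_III_ge:
  assumes "K' < bu"
  shows "of_bool (ereal bu \<le> M_sup M \<omega>) \<le> G_III M bu K' \<omega>"
proof -
  define m where "m = M_inf M \<omega>"
  have "of_bool b \<le> (pos_part (m - K') + (bu - m) * of_bool b) / (bu - K')" for b
    using assms by (cases b) (auto simp: pos_part_def pos_le_divide_eq)
  then show ?thesis
    by (simp add: G_III_def m_def add_divide_distrib)
qed

section \<open>Measurability and integrability\<close>

context ui_continuous_martingale
begin

text \<open>A strict upper bound \<open>y\<close> leaves room for a rational \<open>q\<close>
  between a hitting time and \<open>y\<close>; hitting within \<open>{0..q}\<close> is then a
  countable condition.\<close>

lemma hitting_measurable [measurable]: "hitting M x \<in> borel_measurable P"
proof (rule borel_measurableI_less)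
  fix y :: ennreal
  let ?Q = "{q \<in> \<rat> \<inter> {0..}. ennreal q < y}"
  have "(\<exists>t\<ge>0. ennreal t < y \<and> M t \<omega> = x) \<longleftrightarrow>
      (\<exists>q\<in>?Q. \<forall>k::nat. \<exists>r\<in>\<rat> \<inter> {0..q}. \<bar>M r \<omega> - x\<bar> < 1 / real (Suc k))"
    (is "?L \<longleftrightarrow> ?R") if w: "\<omega> \<in> space P" for \<omega>
  proof -
    have "?L \<longleftrightarrow> (\<exists>q\<in>?Q. \<exists>t\<in>{0..q}. M t \<omega> = x)"
    proof
      assume ?L
      then obtain t where t: "0 \<le> t" "ennreal t < y" "M t \<omega> = x" by blast
      obtain s where s: "t < s" "ennreal s < y"
      proof (cases y)
        case (real r)
        then have "t < r"
          using t by (simp add: ennreal_less_iff)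
        then obtain s where "t < s" "s < r"
          using dense by blast
        then show ?thesis
          using that[of s] t(1) real by (simp add: ennreal_less_iff)
      next
        case top
        then show ?thesis
          using that[of "t + 1"] by simp
      qed
      obtain q where q: "q \<in> \<rat>" "t < q" "q < s"
        using Rats_dense_in_real[OF s(1)] by blast
      have "ennreal q < y"
        using q by (intro le_less_trans[OF _ s(2)] ennreal_leI) simp
      then show "\<exists>q\<in>?Q. \<exists>t\<in>{0..q}. M t \<omega> = x"
        using q t by (intro bexI[of _ q] bexI[of _ t]) auto
    next
      assume "\<exists>q\<in>?Q. \<exists>t\<in>{0..q}. M t \<omega> = x"
      then obtain q t where "ennreal q < y" "0 \<le> t" "t \<le> q" "M t \<omega> = x" by auto
      then show ?L
        by (intro exI[of _ t]) (auto intro: le_less_trans ennreal_leI)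
    qed
    also have "\<dots> \<longleftrightarrow> ?R"
      using continuous_on_attains_iff_rational[OF continuous_path[OF w]] by (intro bex_cong) auto
    finally show ?thesis .
  qed
  then have "{\<omega> \<in> space P. hitting M x \<omega> < y} = {\<omega> \<in> space P.
      \<exists>q\<in>?Q. \<forall>k::nat. \<exists>r\<in>\<rat> \<inter> {0..q}. \<bar>M r \<omega> - x\<bar> < 1 / real (Suc k)}"
    unfolding hitting_less_iff by (intro Collect_cong conj_cong refl)
  also have "\<dots> \<in> sets P"
  proof (intro sets.sets_Collect_countable_All sets.sets_Collect_countable_Ex')
    fix q r k assume "r \<in> \<rat> \<inter> {0..q :: real}"
    then have [measurable]: "M r \<in> borel_measurable P"
      by (auto intro: measurable_M)
    show "{\<omega> \<in> space P. \<bar>M r \<omega> - x\<bar> < 1 / real (Suc k)} \<in> sets P"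
      by measurable
  qed (auto intro: countable_subset[OF _ countable_rat])
  finally show "{\<omega> \<in> space P. hitting M x \<omega> < y} \<in> sets P" .
qed

lemma M_sup_measurable [measurable]: "M_sup M \<in> borel_measurable P"
proof -
  have [measurable]: "(\<lambda>\<omega>. SUP q\<in>\<rat> \<inter> {0..}. ereal (M q \<omega>)) \<in> borel_measurable P"
    by (intro borel_measurable_SUP borel_measurable_ereal measurable_M)
      (auto intro: countable_subset[OF _ countable_rat])
  have "(\<lambda>\<omega>. max (SUP q\<in>\<rat> \<inter> {0..}. ereal (M q \<omega>)) (ereal (M_inf M \<omega>))) \<in> borel_measurable P"
    by measurable
  then show ?thesis
    by (subst measurable_cong[OF M_sup_eq_rational[OF continuous_path]])
qed

lemma integrable_mult_of_bool:
  fixes X :: "'a \<Rightarrow> real"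
  assumes X: "integrable P X" and Q: "{\<omega> \<in> space P. Q \<omega>} \<in> sets P"
  shows "integrable P (\<lambda>\<omega>. X \<omega> * of_bool (Q \<omega>))"
proof -
  have "integrable P (\<lambda>\<omega>. indicator {\<omega> \<in> space P. Q \<omega>} \<omega> * X \<omega>)"
    using integrable_mult_indicator[OF Q X] by simp
  then show ?thesis
    by (rule Bochner_Integration.integrable_cong[THEN iffD1, rotated 2]) (auto simp: indicator_def)
qed

lemma integrable_pos_part: "integrable P X \<Longrightarrow> integrable P (\<lambda>\<omega>. pos_part (X \<omega>))"
  unfolding pos_part_def by (intro integrable_max) auto

lemma G_I_integrable: "integrable P (G_I M bl K)"
proof -
  have "{\<omega> \<in> space P. bl < M_inf M \<omega>} \<in> sets P"
    by measurable
  then have "integrable P (\<lambda>\<omega>. of_bool (bl < M_inf M \<omega>) :: real)"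
    using integrable_mult_of_bool[of "\<lambda>_. 1"] by simp
  then show ?thesis
    unfolding G_I_def
    by (intro Bochner_Integration.integrable_add Bochner_Integration.integrable_diff
        integrable_mult_right integrable_mult_of_bool integrable_pos_part) auto
qed

lemma G_II_integrable: "integrable P (G_II M bl bu)"
  unfolding G_II_def
  by (intro Bochner_Integration.integrable_diff integrable_mult_of_bool integrable_divide) auto

lemma G_III_integrable: "integrable P (G_III M bu K')"
  unfolding G_III_def
  by (intro Bochner_Integration.integrable_add Bochner_Integration.integrable_diff
      integrable_mult_of_bool integrable_divide integrable_pos_part) auto

section \<open>From pathwise domination to expectations\<close>

lemma prob_le_integral:
  fixes G :: "'a \<Rightarrow> real"
  assumes G: "integrable P G" and le: "AE \<omega> in P. of_bool (Q \<omega>) \<le> G \<omega>"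
  shows "prob {\<omega> \<in> space P. Q \<omega>} \<le> (\<integral>\<omega>. G \<omega> \<partial>P)"
proof (cases "{\<omega> \<in> space P. Q \<omega>} \<in> sets P")
  case True
  have "prob {\<omega> \<in> space P. Q \<omega>} = (\<integral>\<omega>. indicator {\<omega> \<in> space P. Q \<omega>} \<omega> \<partial>P)"
    using True by simp
  also have "\<dots> \<le> (\<integral>\<omega>. G \<omega> \<partial>P)"
  proof (rule integral_mono_AE[OF _ G])
    show "AE \<omega> in P. indicator {\<omega> \<in> space P. Q \<omega>} \<omega> \<le> G \<omega>"
      using le AE_space by eventually_elim (auto simp: indicator_def)
  qed (use True in \<open>simp add: integrable_real_indicator less_top[symmetric]\<close>)
  finally show ?thesis .
next
  \<comment> \<open>\<open>measure\<close> assigns 0 to a set outside the sigma-algebra, so here it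
    suffices that \<open>G\<close> is nonnegative almost everywhere.\<close>
  case False
  have "AE \<omega> in P. 0 \<le> G \<omega>"
    using le by eventually_elim (auto split: split_of_bool_asm)
  then show ?thesis
    using False by (simp add: measure_notin_sets integral_nonneg_AE)
qed

end

theorem proposition2p1:
  fixes P :: "'a measure" and F :: "real \<Rightarrow> 'a measure"
    and M :: "real \<Rightarrow> 'a \<Rightarrow> real" and bl bu :: real
  assumes "bl < 0" and "0 < bu"
    and "prob_space P"
    and "is_filtration P F"
    and "is_martingale P F M"
    and "continuous_paths P M"
    and "uniformly_integrable_on P {0..} M"
    and "AE \<omega> in P. M 0 \<omega> = 0"
  shows "ereal (measure P {\<omega> \<in> space P. M_sup M \<omega> \<ge> ereal bu \<and> M_low M \<omega> > ereal bl})
    \<le> (INF (K, K') \<in> {(K, K'). 0 < K' \<and> K' < bu \<and> bu < K}.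
         Inf {ereal (integral\<^sup>L P (G_I M bl K)),
              ereal (integral\<^sup>L P (G_II M bl bu)),
              ereal (integral\<^sup>L P (G_III M bu K'))})"
proof -
  interpret prob_space P by fact
  interpret ui_continuous_martingale P F M
    by unfold_locales fact+
  define E where "E \<omega> \<longleftrightarrow> ereal bu \<le> M_sup M \<omega> \<and> ereal bl < M_low M \<omega>" for \<omega>
  have path: "AE \<omega> in P. M 0 \<omega> = 0 \<and> continuous_on {0..} (\<lambda>t. M t \<omega>) \<and>
      ((\<lambda>t. M t \<omega>) \<longlongrightarrow> M_inf M \<omega>) at_top"
    using assms(8) AE_tendsto_M_inf AE_space by eventually_elim (use continuous_path in blast)
  have I: "prob {\<omega> \<in> space P. E \<omega>} \<le> integral\<^sup>L P (G_I M bl K)" if "bu < K" for K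
  proof (rule prob_le_integral[OF G_I_integrable])
    show "AE \<omega> in P. of_bool (E \<omega>) \<le> G_I M bl K \<omega>"
      using path
    proof eventually_elim
      case (elim \<omega>)
      then have "of_bool (ereal bl < M_low M \<omega>) \<le> G_I M bl K \<omega>"
        using G_I_ge[of bl K M \<omega>] assms(1,2) that by auto
      then show ?case
        by (rule order_trans[rotated]) (simp add: E_def)
    qed
  qed
  have II: "prob {\<omega> \<in> space P. E \<omega>} \<le> integral\<^sup>L P (G_II M bl bu)"
  proof (rule prob_le_integral[OF G_II_integrable])
    show "AE \<omega> in P. of_bool (E \<omega>) \<le> G_II M bl bu \<omega>"
      using path by eventually_elim (auto simp only: E_def intro!: G_II_ge assms(1,2))
  qed
  have III: "prob {\<omega> \<in> space P. E \<omega>} \<le> integral\<^sup>L P (G_III M bu K')" if "K' < bu" for K'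
  proof (rule prob_le_integral[OF G_III_integrable], rule AE_I2)
    fix \<omega>
    show "of_bool (E \<omega>) \<le> G_III M bu K' \<omega>"
      by (rule order_trans[OF _ G_III_ge[OF that]]) (simp add: E_def)
  qed
  show ?thesis
    unfolding E_def[symmetric]
    by (rule INF_greatest) (auto intro!: Inf_greatest I II III)
qed

end
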